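(* Let $h:\mathbb{R}\to(0,\infty)$ be a smooth $1$-periodic function. The eigenvalues $\lambda^2$ of the Sturm--Liouville equation $$-A''(t)=\Bigl\{\lambda^2h^4(t)+\frac{h(t)h''(t)-2(h'(t))^2}{h^2(t)}\Bigr\}A(t)$$ (that is, the values $\lambda^2$ for which a nontrivial $1$-periodic solution $A$ exists) are exactly the numbers $$\lambda^2=\frac{4\pi^2n^2}{\Bigl(\int_0^1h^2(t)\,dt\Bigr)^2},\qquad n\in\mathbb{Z}.$$
   Context: This equation describes the $S^1$-invariant (weight $l=0$) eigenspinors of the square of the Dirac operator on the torus $T^2=\mathbb{R}^2/\mathbb{Z}^2$ with metric $h^4(t)(dt^2+dy^2)$ and trivial spin structure. Solutions $A$ are allowed to be complex-valued. *)

theory Defs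
  imports "HOL-Analysis.Analysis"
begin

definition smooth_real :: "(real \<Rightarrow> real) \<Rightarrow> bool" where
  "smooth_real f \<longleftrightarrow> (\<forall>k. ((deriv ^^ k) f) differentiable_on UNIV)"

definition one_periodic :: "(real \<Rightarrow> 'a) \<Rightarrow> bool" where
  "one_periodic f \<longleftrightarrow> (\<forall>t. f (t + 1) = f t)"

definition SL_potential :: "(real \<Rightarrow> real) \<Rightarrow> real \<Rightarrow> real" where
  "SL_potential h t = (h t * deriv (deriv h) t - 2 * (deriv h t)\<^sup>2) / (h t)\<^sup>2"

definition SL_solution :: "(real \<Rightarrow> real) \<Rightarrow> complex \<Rightarrow> (real \<Rightarrow> complex) \<Rightarrow> bool" where
  "SL_solution h \<mu> A \<longleftrightarrow>
     (\<exists>A' A''. (\<forall>t. (A has_vector_derivative A' t) (at t)) \<and>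
               (\<forall>t. (A' has_vector_derivative A'' t) (at t)) \<and>
               (\<forall>t. - A'' t = (\<mu> * of_real (h t ^ 4) + of_real (SL_potential h t)) * A t))"

(* The parameter \<mu> plays the role of lambda^2. It ranges over all complex numbers
   (equivalently, lambda does), so that its being real and nonnegative is not presupposed. *)
definition SL_eigenvalue :: "(real \<Rightarrow> real) \<Rightarrow> complex \<Rightarrow> bool" where
  "SL_eigenvalue h \<mu> \<longleftrightarrow>
     (\<exists>A. SL_solution h \<mu> A \<and> one_periodic A \<and> (\<exists>t. A t \<noteq> 0))"

end

theory Submission
  imports Defs
begin

text \<open>
  Substitute \<open>A = u / h\<close> and use \<open>\<phi>\<close> with \<open>\<phi>' = h\<^sup>2\<close> as a new independent variable: the equation becomes
  \<open>d\<^sup>2u/d\<phi>\<^sup>2 = - \<mu> u\<close>, and a unit step in \<open>t\<close> is a step of length \<open>L = \<integral>\<^sub>0\<^sup>1 h\<^sup>2\<close> in \<open>\<phi>\<close>.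
  With \<open>\<mu> = \<omega>\<^sup>2\<close> and \<open>w = du/d\<phi>\<close>, the combinations \<open>w \<plusminus> \<i>\<omega>u\<close> are multiples of \<open>exp (\<plusminus>\<i>\<omega>\<phi>)\<close>,
  so a nontrivial periodic solution forces \<open>exp (\<i>\<omega>L) = 1\<close> or \<open>\<omega> = 0\<close>.
\<close>

section \<open>Derivatives and antiderivatives of periodic functions\<close>

lemma has_vector_derivative_shift:
  fixes f :: "real \<Rightarrow> 'a::real_normed_vector"
  assumes "(f has_vector_derivative D) (at (t + a))"
  shows "((\<lambda>s. f (s + a)) has_vector_derivative D) (at t)"
proof -
  have "((\<lambda>s. s + a) has_real_derivative 1) (at t)"
    by (auto intro!: derivative_eq_intros)
  then have "((\<lambda>s. s + a) has_vector_derivative 1) (at t)"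
    by (simp only: has_real_derivative_iff_has_vector_derivative)
  from vector_diff_chain_at[OF this assms] show ?thesis
    by (simp add: o_def)
qed

lemma has_vector_derivative_periodic:
  fixes f :: "real \<Rightarrow> 'a::real_normed_vector"
  assumes "\<And>t. (f has_vector_derivative f' t) (at t)" and "one_periodic f"
  shows "one_periodic f'"
  unfolding one_periodic_def
proof
  fix t
  have "(f has_vector_derivative f' (t + 1)) (at t)"
    using has_vector_derivative_shift[OF assms(1), of 1 t] assms(2)
    by (simp add: one_periodic_def)
  then show "f' (t + 1) = f' t"
    using assms(1) by (rule vector_derivative_unique_at)
qed

lemma has_vector_derivative_zero_const:
  fixes f :: "real \<Rightarrow> 'a::real_normed_vector"
  assumes "\<And>t. (f has_vector_derivative 0) (at t)"
  shows "f s = f t"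
proof -
  obtain c where "\<And>x. x \<in> UNIV \<Longrightarrow> f x = c"
    by (rule has_vector_derivative_zero_constant[of UNIV f]) (use assms in auto)
  then show ?thesis by simp
qed

text \<open>By periodicity of \<open>f\<close>, the difference \<open>F (t + 1) - F t\<close> has
  derivative zero; its constant value is read off at \<open>t = 0\<close>. Applied to the square of
  \<open>h\<close>, this supplies the new variable \<open>\<phi>\<close>.\<close>

lemma antiderivative_periodic:
  fixes f :: "real \<Rightarrow> real"
  assumes "continuous_on UNIV f" and "one_periodic f"
  obtains F where "\<And>t. (F has_real_derivative f t) (at t)"
    and "\<And>t. F (t + 1) = F t + integral {0..1} f"
proof -
  obtain F where F: "\<And>t. (F has_vector_derivative f t) (at t)"
    using einterval_antiderivative[of "-\<infinity>" \<infinity> f] assms(1)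
    by (auto simp: continuous_on_eq_continuous_at)
  have int: "(f has_integral (F 1 - F 0)) {0..1}"
    by (rule fundamental_theorem_of_calculus) (auto intro: has_vector_derivative_at_within F)
  have "((\<lambda>s. F (s + 1) - F s) has_vector_derivative 0) (at t)" for t
    using has_vector_derivative_diff[OF has_vector_derivative_shift[OF F] F, of 1 t] assms(2)
    by (simp add: one_periodic_def)
  then have "F (t + 1) - F t = F (0 + 1) - F 0" for t
    by (rule has_vector_derivative_zero_const)
  moreover have "integral {0..1} f = F 1 - F 0"
    using int by (rule integral_unique)
  ultimately have "F (t + 1) = F t + integral {0..1} f" for t
    by (metis add.commute add_0 diff_add_cancel)
  with F show ?thesis
    by (intro that) (auto simp: has_real_derivative_iff_has_vector_derivative)
qed

section \<open>First-order linear equations in the variable \<open>\<phi>\<close>\<close>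

lemma has_vector_derivative_exp_scaled:
  fixes \<phi> :: "real \<Rightarrow> real"
  assumes "(\<phi> has_real_derivative d) (at t)"
  shows "((\<lambda>s. exp (c * complex_of_real (\<phi> s)))
          has_vector_derivative c * of_real d * exp (c * of_real (\<phi> t))) (at t)"
proof -
  have "((\<lambda>s. complex_of_real (\<phi> s)) has_vector_derivative of_real d) (at t)"
    using assms by (rule has_vector_derivative_of_real)
  then have "((\<lambda>s. c * complex_of_real (\<phi> s)) has_vector_derivative c * of_real d) (at t)"
    by (rule has_vector_derivative_mult_right)
  from field_vector_diff_chain_at[OF this DERIV_exp] show ?thesis
    by (simp add: o_def)
qed

text \<open>Integrating factor: multiplying \<open>p\<close> by \<open>exp (- c * \<phi>)\<close>
  gives a function with zero derivative.\<close>

lemma linear_ode_solution: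
  fixes p :: "real \<Rightarrow> complex" and \<phi> d :: "real \<Rightarrow> real"
  assumes \<phi>: "\<And>t. (\<phi> has_real_derivative d t) (at t)"
    and p: "\<And>t. (p has_vector_derivative c * of_real (d t) * p t) (at t)"
  shows "p t = p s * exp (c * of_real (\<phi> t - \<phi> s))"
proof -
  have "((\<lambda>r. p r * exp ((-c) * of_real (\<phi> r))) has_vector_derivative 0) (at r)" for r
    using has_vector_derivative_mult[OF p has_vector_derivative_exp_scaled[OF \<phi>, of "-c"], of r]
    by (simp add: algebra_simps)
  then have "p t * exp ((-c) * of_real (\<phi> t)) = p s * exp ((-c) * of_real (\<phi> s))"
    by (rule has_vector_derivative_zero_const)
  then show ?thesis
    by (simp add: exp_minus exp_diff field_simps)
qed

text \<open>Over one period every solution is multiplied by \<open>exp (c * L)\<close>, its Floquet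
  multiplier. If that factor is not 1, periodicity leaves only the zero solution.\<close>

lemma linear_ode_periodic:
  fixes p :: "real \<Rightarrow> complex" and \<phi> d :: "real \<Rightarrow> real"
  assumes \<phi>: "\<And>t. (\<phi> has_real_derivative d t) (at t)"
    and shift: "\<And>t. \<phi> (t + 1) = \<phi> t + L"
    and p: "\<And>t. (p has_vector_derivative c * of_real (d t) * p t) (at t)"
    and per: "one_periodic p"
    and nz: "exp (c * of_real L) \<noteq> 1"
  shows "p t = 0"
  using linear_ode_solution[OF \<phi> p, of "t + 1" t] shift[of t] per nz
  by (auto simp: one_periodic_def)

text \<open>The exponent must lie in \<open>2 * pi * \<i>\<close> times the integers. Its vanishing
  real part makes the complex number \<open>\<omega>\<close> real, so the eigenvalue comes out real
  and nonnegative; the imaginary part gives \<open>n\<close>.\<close>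

lemma exp_i_mult_eq_1_square:
  assumes "exp (\<i> * \<omega> * of_real L) = 1" and "L > 0"
  obtains n :: int where "\<omega>\<^sup>2 = complex_of_real (4 * pi\<^sup>2 * (real_of_int n)\<^sup>2 / L\<^sup>2)"
proof -
  obtain n :: int where re: "Re (\<i> * \<omega> * of_real L) = 0"
    and im: "Im (\<i> * \<omega> * of_real L) = of_int (2 * n) * pi"
    using assms(1) exp_eq_1 by blast
  have "\<omega> = of_real (2 * real_of_int n * pi / L)"
    using re im assms(2) by (auto simp: complex_eq_iff field_simps)
  then have "\<omega>\<^sup>2 = of_real (4 * pi\<^sup>2 * (real_of_int n)\<^sup>2 / L\<^sup>2)"
    by (simp add: power_divide power_mult_distrib algebra_simps)
  then show ?thesis by (rule that)
qed

lemma smooth_real_DERIV: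
  assumes "smooth_real f"
  shows "(f has_real_derivative deriv f t) (at t)"
    and "(deriv f has_real_derivative deriv (deriv f) t) (at t)"
proof -
  have "((deriv ^^ k) f) differentiable at t" for k
    using assms by (auto simp: smooth_real_def differentiable_on_def)
  from this[of 0] this[of 1]
  show "(f has_real_derivative deriv f t) (at t)"
    and "(deriv f has_real_derivative deriv (deriv f) t) (at t)"
    by (auto simp: DERIV_deriv_iff_real_differentiable)
qed

theorem proposition2:
  fixes h :: "real \<Rightarrow> real"
  assumes "smooth_real h"
    and "one_periodic h"
    and "\<And>t. h t > 0"
  shows "{\<mu>. SL_eigenvalue h \<mu>} =
    {complex_of_real (4 * pi\<^sup>2 * (real_of_int n)\<^sup>2 / (integral {0..1} (\<lambda>t. (h t)\<^sup>2))\<^sup>2) | n :: int. True}"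
proof -

  \<comment> \<open>Change of variables\<close>
  define L where "L = integral {0..1} (\<lambda>t. (h t)\<^sup>2)"
  define H where "H = (\<lambda>t. complex_of_real (h t))"
  define H' where "H' = (\<lambda>t. complex_of_real (deriv h t))"
  define H'' where "H'' = (\<lambda>t. complex_of_real (deriv (deriv h) t))"
  \<comment> \<open>With the reciprocal named, \<open>A\<close>, the potential and all derivatives
    are polynomial in \<open>G\<close>, \<open>H\<close>, \<open>H'\<close>, \<open>H''\<close>, and
    divisions are replaced by the single relation \<open>H * G = 1\<close>.\<close>
  define G where "G = (\<lambda>t. inverse (H t))"
  have Hnz [simp]: "H t \<noteq> 0" for t
    using assms(3)[of t] by (simp add: H_def)
  have dH: "(H has_vector_derivative H' t) (at t)" for t
    unfolding H_def H'_def by (intro has_vector_derivative_of_real smooth_real_DERIV assms)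
  have dH': "(H' has_vector_derivative H'' t) (at t)" for t
    unfolding H''_def H'_def by (intro has_vector_derivative_of_real smooth_real_DERIV assms)
  have HG: "H t * G t = 1" for t
    by (simp add: G_def)
  have dG: "(G has_vector_derivative - H' t * (G t)\<^sup>2) (at t)" for t
    using field_vector_diff_chain_at[OF dH DERIV_inverse[OF Hnz], of t]
    by (simp add: G_def o_def power2_eq_square)
  have H_per: "one_periodic H" and G_per: "one_periodic G"
    using assms(2) by (auto simp: one_periodic_def H_def G_def)
  have H'_per: "one_periodic H'"
    using dH H_per by (rule has_vector_derivative_periodic)
  have pot: "of_real (SL_potential h t) = H'' t * G t - 2 * (H' t)\<^sup>2 * (G t)\<^sup>2" for t
    using assms(3)[of t]
    by (simp add: SL_potential_def H''_def H'_def H_def G_def field_simps power2_eq_square)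
  have cont: "continuous_on UNIV (\<lambda>t. (h t)\<^sup>2)"
    using smooth_real_DERIV(1)[OF assms(1)]
    by (intro continuous_intros continuous_at_imp_continuous_on) (auto intro: DERIV_isCont)
  have h2_per: "one_periodic (\<lambda>t. (h t)\<^sup>2)"
    using assms(2) by (simp add: one_periodic_def)
  obtain \<phi> where \<phi>: "\<And>t. (\<phi> has_real_derivative (h t)\<^sup>2) (at t)"
    and shift: "\<And>t. \<phi> (t + 1) = \<phi> t + L"
    using antiderivative_periodic[OF cont h2_per, folded L_def] by blast
  have Lpos: "L > 0"
  proof -
    have "\<phi> 0 < \<phi> 1"
    proof (rule DERIV_pos_imp_increasing[of 0 1 \<phi>])
      show "\<exists>y. (\<phi> has_real_derivative y) (at t) \<and> y > 0" for t
        using \<phi>[of t] assms(3)[of t] by (intro exI[of _ "(h t)\<^sup>2"]) simp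
    qed simp
    with shift[of 0] show ?thesis by simp
  qed

  \<comment> \<open>Necessity: periodic solutions force the listed values\<close>
  have "\<exists>n::int. \<mu> = of_real (4 * pi\<^sup>2 * (real_of_int n)\<^sup>2 / L\<^sup>2)" if ev: "SL_eigenvalue h \<mu>" for \<mu>
  proof -
    obtain A A' A'' t0 where A: "\<And>t. (A has_vector_derivative A' t) (at t)"
      and A': "\<And>t. (A' has_vector_derivative A'' t) (at t)"
      and eq: "\<And>t. - A'' t = (\<mu> * of_real (h t ^ 4) + of_real (SL_potential h t)) * A t"
      and A_per: "one_periodic A" and A_nz: "A t0 \<noteq> 0"
      using ev unfolding SL_eigenvalue_def SL_solution_def by blast
    define u where "u = (\<lambda>t. H t * A t)"
    \<comment> \<open>This is du/d\<open>\<phi>\<close>, that is (\<open>H * A' + H' * A\<close>)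
      divided by the square of \<open>H\<close>.\<close>
    define w where "w = (\<lambda>t. G t * A' t + H' t * (G t)\<^sup>2 * A t)"
    \<comment> \<open>Every complex \<open>\<mu>\<close> has a square root, so neither reality nor
      sign is presupposed; both roots enter symmetrically below.\<close>
    define \<omega> where "\<omega> = csqrt \<mu>"
    have \<omega>: "\<omega>\<^sup>2 = \<mu>"
      by (simp add: \<omega>_def)
    have A'_per: "one_periodic A'"
      using A A_per by (rule has_vector_derivative_periodic)
    have per: "one_periodic (\<lambda>t. w t + c * u t)" for c
      using A_per A'_per H_per H'_per G_per by (auto simp: one_periodic_def u_def w_def)
    have du: "(u has_vector_derivative of_real ((h t)\<^sup>2) * w t) (at t)" for t
    proof -
      have "of_real ((h t)\<^sup>2) * w t = (H t * (H t * G t)) * A' t + H' t * (H t * G t)\<^sup>2 * A t"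
        by (simp add: w_def H_def algebra_simps power2_eq_square)
      also have "\<dots> = H t * A' t + H' t * A t"
        by (simp add: HG)
      finally show ?thesis
        using has_vector_derivative_mult[OF dH A, of t] by (simp add: u_def)
    qed
    \<comment> \<open>In the derivative of \<open>w\<close> the two \<open>A'\<close> terms cancel,
      and the potential in the equation for \<open>A''\<close> cancels exactly the terms in
      \<open>H''\<close> and the square of \<open>H'\<close>. Only the \<open>\<mu>\<close> term
      survives.\<close>
    have dw: "(w has_vector_derivative - \<mu> * of_real ((h t)\<^sup>2) * u t) (at t)" for t
    proof -
      have "- A'' t = (\<mu> * H t ^ 4 + (H'' t * G t - 2 * (H' t)\<^sup>2 * (G t)\<^sup>2)) * A t"
        using eq[of t] by (simp add: pot H_def)
      then have A'': "A'' t = - ((\<mu> * H t ^ 4 + (H'' t * G t - 2 * (H' t)\<^sup>2 * (G t)\<^sup>2)) * A t)"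
        by (metis minus_minus)
      have "G t * A'' t + H'' t * (G t)\<^sup>2 * A t - 2 * (H' t)\<^sup>2 * (G t) ^ 3 * A t
          = - \<mu> * (H t * G t) * H t ^ 3 * A t"
        unfolding A'' by (simp add: algebra_simps power2_eq_square power3_eq_cube power4_eq_xxxx)
      also have "\<dots> = - \<mu> * of_real ((h t)\<^sup>2) * u t"
        unfolding HG by (simp add: u_def H_def power2_eq_square power3_eq_cube)
      finally have *: "- \<mu> * of_real ((h t)\<^sup>2) * u t =
        G t * A'' t + H'' t * (G t)\<^sup>2 * A t - 2 * (H' t)\<^sup>2 * (G t) ^ 3 * A t" ..
      have "((\<lambda>t. G t * A' t + H' t * (G t * G t) * A t) has_vector_derivative
         (G t * A'' t + (- H' t * (G t)\<^sup>2) * A' t) +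
         (H' t * (G t * G t) * A' t +
          (H' t * (G t * (- H' t * (G t)\<^sup>2) + (- H' t * (G t)\<^sup>2) * G t) + H'' t * (G t * G t)) * A t)) (at t)"
        by (intro has_vector_derivative_add has_vector_derivative_mult dG dH' A A')
      then show ?thesis
        unfolding * by (simp add: w_def algebra_simps power2_eq_square power3_eq_cube)
    qed
    \<comment> \<open>The system for \<open>u\<close> and \<open>w\<close> is decoupled:
      \<open>w + c * u\<close> satisfies a scalar equation when \<open>c\<close> is one of the two
      square roots of \<open>- \<mu>\<close>.\<close>
    have dp: "((\<lambda>t. w t + c * u t) has_vector_derivative
        c * of_real ((h t)\<^sup>2) * (w t + c * u t)) (at t)" if "c\<^sup>2 = - \<mu>" for c t
    proof -
      have \<mu>: "\<mu> = - (c * c)"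
        using that by (simp add: power2_eq_square)
      show ?thesis
        using has_vector_derivative_add[OF dw has_vector_derivative_mult_right[OF du, of c], of t]
        unfolding \<mu> by (simp add: algebra_simps)
    qed
    have zero: "w t0 + c * u t0 = 0" if "c\<^sup>2 = - \<mu>" and "exp (c * of_real L) \<noteq> 1" for c
      by (rule linear_ode_periodic[OF \<phi> shift dp[OF that(1)] per that(2)])
    have "exp (\<i> * \<omega> * of_real L) = 1 \<or> \<omega> = 0"
    proof (rule ccontr)
      assume *: "\<not> ?thesis"
      \<comment> \<open>The multipliers for the two roots are reciprocal, so neither is 1. Both
        combinations then vanish at \<open>t0\<close>, and as \<open>\<omega>\<close> is nonzero, so
        does \<open>u t0\<close>, against \<open>A t0 \<noteq> 0\<close>.\<close>
      then have ne: "exp (- \<i> * \<omega> * of_real L) \<noteq> 1"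
        by (simp add: exp_minus)
      have "w t0 + (- \<i> * \<omega>) * u t0 = 0"
        by (rule zero[OF _ ne]) (simp add: power_mult_distrib \<omega>)
      moreover have "w t0 + (\<i> * \<omega>) * u t0 = 0"
        by (rule zero) (use * in \<open>simp_all add: power_mult_distrib \<omega>\<close>)
      ultimately have "\<omega> * u t0 = 0"
        by (simp add: add_eq_0_iff)
      then show False
        using * A_nz by (simp add: u_def)
    qed
    \<comment> \<open>The case \<open>\<omega> = 0\<close> satisfies this trivially; it corresponds
      to \<open>n = 0\<close>.\<close>
    then have "exp (\<i> * \<omega> * of_real L) = 1"
      by auto
    then obtain n :: int where "\<omega>\<^sup>2 = of_real (4 * pi\<^sup>2 * (real_of_int n)\<^sup>2 / L\<^sup>2)"
      using Lpos by (rule exp_i_mult_eq_1_square)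
    with \<omega> show ?thesis by auto
  qed

  \<comment> \<open>Sufficiency: explicit periodic eigenfunctions\<close>
  moreover have "SL_eigenvalue h (of_real (4 * pi\<^sup>2 * (real_of_int n)\<^sup>2 / L\<^sup>2))" for n :: int
  proof -
    \<comment> \<open>Chosen so that \<open>c * L\<close> is \<open>2 * pi * n * \<i>\<close>, which
      makes \<open>E\<close> periodic, and so that \<open>- (c * c)\<close> is the required
      eigenvalue. The eigenfunction is \<open>E\<close> divided by \<open>H\<close>.\<close>
    define c where "c = \<i> * of_real (2 * real_of_int n * pi / L)"
    define E where "E = (\<lambda>t. exp (c * of_real (\<phi> t)))"
    define \<mu> where "\<mu> = complex_of_real (4 * pi\<^sup>2 * (real_of_int n)\<^sup>2 / L\<^sup>2)"
    have c2: "\<mu> = - (c * c)"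
      unfolding c_def \<mu>_def complex_eq_iff by (simp add: power2_eq_square)
    have dE: "(E has_vector_derivative c * (H t * H t) * E t) (at t)" for t
      using has_vector_derivative_exp_scaled[OF \<phi>, of c t]
      by (simp add: E_def H_def power2_eq_square)
    have "c * of_real L = 2 * of_int n * of_real pi * \<i>"
      using Lpos by (simp add: c_def)
    then have "exp (c * of_real L) = 1"
      using exp_integer_2pi[of "of_int n"] by (simp add: mult_ac)
    then have E_per: "E (t + 1) = E t" for t
      by (simp add: E_def shift distrib_left exp_add)
    define A where "A = (\<lambda>t. G t * E t)"
    define A' where "A' = (\<lambda>t. c * (H t * E t) - H' t * (G t * G t) * E t)"
    \<comment> \<open>Kept as the raw output of the product rule, so that the derivative rules match
      it directly; it is simplified only when the equation is checked.\<close>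
    define A'' where "A'' = (\<lambda>t. c * (H t * (c * (H t * H t) * E t) + H' t * E t) -
      (H' t * (G t * G t) * (c * (H t * H t) * E t) +
       (H' t * (G t * (- H' t * (G t)\<^sup>2) + (- H' t * (G t)\<^sup>2) * G t) + H'' t * (G t * G t)) * E t))"
    have "(A has_vector_derivative A' t) (at t)" for t
    proof -
      have "G t * (c * (H t * H t) * E t) + - H' t * (G t)\<^sup>2 * E t
          = c * (H t * E t) * (H t * G t) - H' t * (G t * G t) * E t"
        by (simp add: algebra_simps power2_eq_square)
      also have "\<dots> = A' t"
        by (simp add: A'_def HG)
      finally show ?thesis
        using has_vector_derivative_mult[OF dG dE, of t] by (simp only: A_def)
    qed
    moreover have "(A' has_vector_derivative A'' t) (at t)" for t
      unfolding A'_def A''_def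
      by (intro has_vector_derivative_diff has_vector_derivative_mult has_vector_derivative_mult_right
          dG dH dH' dE)
    moreover have "- A'' t = (\<mu> * of_real (h t ^ 4) + of_real (SL_potential h t)) * A t" for t
    proof -
      \<comment> \<open>The terms linear in \<open>H'\<close> are grouped to vanish by
        \<open>H * G = 1\<close>. The next step inserts a factor \<open>H * G\<close>, so that one
        \<open>G\<close> can be split off with \<open>E\<close> to form \<open>A\<close>.\<close>
      have "- A'' t = (- (c * c) * H t ^ 3 + c * H' t * ((H t * G t)\<^sup>2 - 1)
          + H'' t * (G t)\<^sup>2 - 2 * (H' t)\<^sup>2 * (G t) ^ 3) * E t"
        by (simp add: A''_def algebra_simps power2_eq_square power3_eq_cube)
      also have "\<dots> = (\<mu> * ((H t * G t) * H t ^ 3)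
          + H'' t * (G t)\<^sup>2 - 2 * (H' t)\<^sup>2 * (G t) ^ 3) * E t"
        unfolding HG c2 by simp
      also have "\<dots> = (\<mu> * H t ^ 4 + (H'' t * G t - 2 * (H' t)\<^sup>2 * (G t)\<^sup>2)) * A t"
        by (simp add: A_def algebra_simps power2_eq_square power3_eq_cube power4_eq_xxxx)
      finally show ?thesis
        by (simp add: pot H_def)
    qed
    moreover have "one_periodic A"
      using G_per E_per by (simp add: one_periodic_def A_def)
    moreover have "A 0 \<noteq> 0"
      by (simp add: A_def G_def E_def)
    ultimately show ?thesis
      unfolding SL_eigenvalue_def SL_solution_def \<mu>_def by blast
  qed
  ultimately show ?thesis
    unfolding L_def by blast
qed

end
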